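(* There are universally inscribable stacked polytopes with an arbitrary number of vertices: for every dimension $D\ge2$ and every $N\ge D+1$ there is a stacked $D$-polytope with $N$ vertices that is $K$-inscribable for every smooth strictly convex body $K\subset\mathbb{R}^D$.
   Context: A $D$-polytope is a $D$-dimensional convex polytope. A stacked $D$-polytope is a polytope obtained from a $D$-simplex by repeatedly (possibly zero times) stacking a simplex onto a facet, i.e. adding a new vertex beyond exactly one facet and taking the convex hull. A convex body is a full-dimensional compact convex set; it is strictly convex if its boundary contains no segment, and smooth if every boundary point has a unique supporting hyperplane. A polytope is $K$-inscribed if all its vertices lie on $\partial K$, and $K$-inscribable if it is combinatorially equivalent (isomorphic face lattice) to a $K$-inscribed polytope. A polytope is universally inscribable if it is $K$-inscribable for every smooth strictly convex body $K$ (of the same dimension). *)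

theory Defs
  imports "HOL-Analysis.Analysis"
begin

definition vertices :: "'a::euclidean_space set \<Rightarrow> 'a set" where
  "vertices P = {v. v extreme_point_of P}"

text \<open>
  If \<open>F\<close> is a facet of a polytope \<open>P\<close> and \<open>v\<close> lies in the affine hull of \<open>P\<close>, then
  the trace on that hull of a hyperplane cutting out \<open>F\<close> is unique, so the two
  definitions below do not depend on the choice of \<open>a\<close> and \<open>b\<close>.
\<close>

definition beyond :: "'a::euclidean_space \<Rightarrow> 'a set \<Rightarrow> 'a set \<Rightarrow> bool" where
  "beyond v F P \<longleftrightarrow>
     (\<exists>a b. P \<subseteq> {x. a \<bullet> x \<le> b} \<and> F = P \<inter> {x. a \<bullet> x = b} \<and> a \<bullet> v > b)"

definition beneath :: "'a::euclidean_space \<Rightarrow> 'a set \<Rightarrow> 'a set \<Rightarrow> bool" where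
  "beneath v F P \<longleftrightarrow>
     (\<exists>a b. P \<subseteq> {x. a \<bullet> x \<le> b} \<and> F = P \<inter> {x. a \<bullet> x = b} \<and> a \<bullet> v < b)"

text \<open>
  The new vertex must be strictly beneath every facet other than \<open>F\<close>: a vertex on the
  hyperplane of a further facet would enlarge that facet instead of adding a simplex
  over \<open>F\<close> only.
\<close>

inductive stacked_polytope :: "nat \<Rightarrow> 'a::euclidean_space set \<Rightarrow> bool" for D :: nat where
  simplex: "int D simplex P \<Longrightarrow> stacked_polytope D P"
| stack: "\<lbrakk>stacked_polytope D P; F facet_of P; v \<in> affine hull P; beyond v F P;
           \<And>G. G facet_of P \<Longrightarrow> G \<noteq> F \<Longrightarrow> beneath v G P\<rbrakk>
          \<Longrightarrow> stacked_polytope D (convex hull (insert v P))"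

definition convex_body :: "'a::euclidean_space set \<Rightarrow> bool" where
  "convex_body K \<longleftrightarrow> compact K \<and> convex K \<and> aff_dim K = int DIM('a)"

definition strictly_convex :: "'a::euclidean_space set \<Rightarrow> bool" where
  "strictly_convex K \<longleftrightarrow> (\<forall>x y. x \<noteq> y \<longrightarrow> \<not> closed_segment x y \<subseteq> frontier K)"

definition supporting_hyperplane :: "'a::euclidean_space set \<Rightarrow> 'a \<Rightarrow> 'a set \<Rightarrow> bool" where
  "supporting_hyperplane K x H \<longleftrightarrow>
     (\<exists>a b. a \<noteq> 0 \<and> H = {y. a \<bullet> y = b} \<and> x \<in> H \<and> K \<subseteq> {y. a \<bullet> y \<le> b})"

definition smooth_body :: "'a::euclidean_space set \<Rightarrow> bool" where
  "smooth_body K \<longleftrightarrow> (\<forall>x\<in>frontier K. \<exists>!H. supporting_hyperplane K x H)"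

text \<open>
  The faces in the sense of \<open>face_of\<close> include the empty face and the polytope itself,
  so they form the full face lattice.
\<close>

definition combinatorially_equivalent ::
    "'a::euclidean_space set \<Rightarrow> 'b::euclidean_space set \<Rightarrow> bool" where
  "combinatorially_equivalent P Q \<longleftrightarrow>
     (\<exists>f. bij_betw f {F. F face_of P} {G. G face_of Q} \<and>
          (\<forall>F F'. F face_of P \<longrightarrow> F' face_of P \<longrightarrow> (F \<subseteq> F' \<longleftrightarrow> f F \<subseteq> f F')))"

definition inscribed :: "'a::euclidean_space set \<Rightarrow> 'a set \<Rightarrow> bool" where
  "inscribed K Q \<longleftrightarrow> polytope Q \<and> vertices Q \<subseteq> frontier K"

definition inscribable :: "'a::euclidean_space set \<Rightarrow> 'a set \<Rightarrow> bool" where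
  "inscribable K P \<longleftrightarrow> (\<exists>Q. inscribed K Q \<and> combinatorially_equivalent P Q)"

text \<open>
  The bodies are full-dimensional in the ambient space, so this is the intended notion
  for full-dimensional polytopes \<open>P\<close>.
\<close>

definition universally_inscribable :: "'a::euclidean_space set \<Rightarrow> bool" where
  "universally_inscribable P \<longleftrightarrow>
     (\<forall>K. convex_body K \<and> smooth_body K \<and> strictly_convex K \<longrightarrow> inscribable K P)"

end

theory Submission imports Defs begin

text \<open>
  Let \<open>v\<close> be a vertex of a polytope \<open>P\<close> inscribed in a smooth strictly convex body \<open>K\<close>,
  and suppose that near \<open>v\<close> the polytope is the corner of a \<open>D\<close>-simplex, so that exactly \<open>D\<close>
  facets meet at \<open>v\<close>. Seen from close to \<open>v\<close>, smoothness makes the boundary of \<open>K\<close> look like the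
  tangent hyperplane \<open>T\<close> at \<open>v\<close>, and strict convexity puts every other vertex of \<open>P\<close>
  strictly on one side of \<open>T\<close>. The \<open>D\<close> facet hyperplanes at \<open>v\<close> cut \<open>T\<close> into regions, and
  for \<open>D \<ge> 2\<close> each prescribed one of the \<open>D\<close> facets has a region of \<open>T\<close> which is
  beyond that facet and beneath the others. A point of the boundary of \<open>K\<close> near \<open>v\<close> in such
  a direction is therefore beyond exactly the prescribed facet: it can be stacked on without
  leaving the boundary of \<open>K\<close>. The new vertex again lies on exactly \<open>D\<close> facets, those of
  the new simplex, so the construction can go on from there, starting from any simplex
  inscribed in \<open>K\<close>.

  The vertices are numbered so that the simplices used are spanned by consecutive indices
  \<open>k, \<dots>, k + D\<close>. The index sets of the facets are then given by a recursion,
  \<open>stacking_family\<close>, in which \<open>K\<close> does not appear (\<open>ex_inscribed_stacking\<close>). The face lattice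
  of a polytope is determined by the index sets of its facets
  (\<open>combinatorially_equivalentI\<close>), so the polytopes obtained from different bodies are
  combinatorially equivalent, and the one obtained from the unit ball is universally inscribable.

  The two main ingredients are \<open>frontier_point_in_cone\<close>, which finds the new vertex on the
  boundary of \<open>K\<close>, and \<open>facet_sets_stack\<close>, which computes the facets after stacking.
\<close>

section \<open>Faces and facets as index sets\<close>

definition on_face :: "('i \<Rightarrow> 'a) \<Rightarrow> 'i set \<Rightarrow> 'a set \<Rightarrow> 'i set" where
  "on_face p I F = {i \<in> I. p i \<in> F}"

text \<open>
  Recording a facet by the indices of the vertices on it allows polytopes with different
  vertices, inscribed in different bodies, to be compared by an equation between two families
  of finite sets.
\<close>

definition facet_sets :: "('i \<Rightarrow> 'a::euclidean_space) \<Rightarrow> 'i set \<Rightarrow> 'i set set" where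
  "facet_sets p I = on_face p I ` {F. F facet_of (convex hull (p ` I))}"

lemma face_eq_hull_on_face:
  fixes p :: "'i \<Rightarrow> 'a::euclidean_space"
  assumes "finite I" and F: "F face_of (convex hull (p ` I))"
  shows "F = convex hull (p ` on_face p I F)"
proof -
  have "compact (p ` I)" using assms(1) by (simp add: finite_imp_compact)
  then obtain S where S: "S \<subseteq> p ` I" "F = convex hull S"
    using F face_of_convex_hull_subset by blast
  have "S \<subseteq> p ` on_face p I F"
    using S hull_subset[of S convex] unfolding on_face_def by blast
  moreover have "convex F" using F face_of_imp_convex by blast
  ultimately show ?thesis
    using S(2) hull_minimal[of "p ` on_face p I F" F convex] hull_mono[of S "p ` on_face p I F" convex]
    by (auto simp: on_face_def)
qed

lemma on_face_subset_iff:
  fixes p :: "'i \<Rightarrow> 'a::euclidean_space"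
  assumes "finite I" "F face_of (convex hull (p ` I))" "G face_of (convex hull (p ` I))"
  shows "F \<subseteq> G \<longleftrightarrow> on_face p I F \<subseteq> on_face p I G"
proof
  show "F \<subseteq> G \<Longrightarrow> on_face p I F \<subseteq> on_face p I G" by (auto simp: on_face_def)
next
  assume "on_face p I F \<subseteq> on_face p I G"
  then have "convex hull (p ` on_face p I F) \<subseteq> convex hull (p ` on_face p I G)"
    by (intro hull_mono image_mono)
  then show "F \<subseteq> G"
    using face_eq_hull_on_face[OF assms(1,2)] face_eq_hull_on_face[OF assms(1,3)] by simp
qed

lemma on_face_Inter:
  assumes "A \<noteq> {}"
  shows "on_face p I (\<Inter>A) = \<Inter>(on_face p I ` A)"
  using assms by (auto simp: on_face_def)

lemma polyhedron_hull_image: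
  fixes p :: "'i \<Rightarrow> 'a::euclidean_space"
  shows "finite I \<Longrightarrow> polyhedron (convex hull (p ` I))"
  by (intro polytope_imp_polyhedron polytope_convex_hull) simp

text \<open>
  A proper nonempty face is an intersection of facets, so the right-hand side refers to the
  facets only. The empty face is listed separately, since it need not be such an intersection
  when the polytope is a point.
\<close>

lemma face_sets_eq:
  fixes p :: "'i \<Rightarrow> 'a::euclidean_space"
  assumes fin: "finite I"
  shows "on_face p I ` {F. F face_of (convex hull (p ` I))} =
         {{}, I} \<union> Inter ` (Pow (facet_sets p I) - {{}})" (is "?L = ?R")
proof
  let ?P = "convex hull (p ` I)"
  show "?L \<subseteq> ?R"
  proof (intro image_subsetI)
    fix F assume "F \<in> {F. F face_of ?P}"
    then have F: "F face_of ?P" by simp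
    have "F = {}" if no: "on_face p I F \<notin> Inter ` (Pow (facet_sets p I) - {{}})"
      "on_face p I F \<noteq> I"
    proof (rule ccontr)
      assume ne: "F \<noteq> {}"
      have "on_face p I ?P = I" by (auto simp: on_face_def hull_inc)
      then have "F \<noteq> ?P" using no by auto
      then have FI: "F = \<Inter>{G. G facet_of ?P \<and> F \<subseteq> G}"
        using face_of_polyhedron[OF polyhedron_hull_image[OF fin] F ne] by blast
      let ?A = "{G. G facet_of ?P \<and> F \<subseteq> G}"
      have "?A \<noteq> {}"
      proof
        assume "?A = {}"
        then have "F = UNIV" using FI by (metis Inf_empty)
        then show False using \<open>F \<noteq> ?P\<close> face_of_imp_subset[OF F] by auto
      qed
      then have "on_face p I F = \<Inter>(on_face p I ` ?A)"
        using on_face_Inter[of ?A p I] FI by simp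
      moreover have "on_face p I ` ?A \<in> Pow (facet_sets p I) - {{}}"
        using \<open>?A \<noteq> {}\<close> by (auto simp: facet_sets_def)
      ultimately show False using no by blast
    qed
    then show "on_face p I F \<in> ?R" by (auto simp: on_face_def)
  qed
  show "?R \<subseteq> ?L"
  proof
    fix S assume "S \<in> ?R"
    then consider "S = {}" | "S = I" | T where "T \<subseteq> facet_sets p I" "T \<noteq> {}" "S = \<Inter>T" by blast
    then show "S \<in> ?L"
    proof cases
      case 1
      then have "S = on_face p I {}" by (simp add: on_face_def)
      then show ?thesis by blast
    next
      case 2
      then have "S = on_face p I ?P" by (auto simp: on_face_def hull_inc)
      then show ?thesis using face_of_refl[of ?P] by blast
    next
      case 3
      then obtain A where A: "A \<subseteq> {F. F facet_of ?P}" "T = on_face p I ` A"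
        unfolding facet_sets_def using subset_imageE by metis
      then have "A \<noteq> {}" using 3 by auto
      then have "\<Inter>A face_of ?P" using A face_of_Inter facet_of_imp_face_of by blast
      moreover have "S = on_face p I (\<Inter>A)" using on_face_Inter[OF \<open>A \<noteq> {}\<close>] A 3 by metis
      ultimately show ?thesis by blast
    qed
  qed
qed

text \<open>
  A face is mapped to the face of the other polytope with the same index set. By
  \<open>face_sets_eq\<close> both polytopes have the same index sets of faces.
\<close>

lemma combinatorially_equivalentI:
  fixes p :: "'i \<Rightarrow> 'a::euclidean_space" and q :: "'i \<Rightarrow> 'b::euclidean_space"
  assumes fin: "finite I" and eq: "facet_sets p I = facet_sets q I"
  shows "combinatorially_equivalent (convex hull (p ` I)) (convex hull (q ` I))"
proof -
  let ?P = "{F. F face_of (convex hull (p ` I))}" and ?Q = "{F. F face_of (convex hull (q ` I))}"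
  have inj: "inj_on (on_face p I) ?P" "inj_on (on_face q I) ?Q"
    using on_face_subset_iff[OF fin] by (auto intro!: inj_onI)+
  have im: "on_face p I ` ?P = on_face q I ` ?Q"
    by (simp add: face_sets_eq[OF fin] eq)
  define f where "f = the_inv_into ?Q (on_face q I) \<circ> on_face p I"
  have bij: "bij_betw f ?P ?Q"
    unfolding f_def
    by (rule bij_betw_trans[OF inj_on_imp_bij_betw[OF inj(1)]])
       (simp add: im bij_betw_the_inv_into inj_on_imp_bij_betw inj(2))
  have f: "f F face_of (convex hull (q ` I)) \<and> on_face q I (f F) = on_face p I F"
    if "F face_of (convex hull (p ` I))" for F
  proof -
    have "on_face p I F \<in> on_face q I ` ?Q" using that im by blast
    then have "on_face q I (f F) = on_face p I F"
      unfolding f_def using f_the_inv_into_f[OF inj(2)] by simp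
    moreover have "f F \<in> ?Q" using bij that unfolding bij_betw_def by blast
    ultimately show ?thesis by blast
  qed
  have "F \<subseteq> F' \<longleftrightarrow> f F \<subseteq> f F'"
    if F: "F face_of (convex hull (p ` I))" "F' face_of (convex hull (p ` I))" for F F'
    unfolding on_face_subset_iff[OF fin F]
      on_face_subset_iff[OF fin conjunct1[OF f[OF F(1)]] conjunct1[OF f[OF F(2)]]]
    using f[OF F(1)] f[OF F(2)] by simp
  then show ?thesis
    unfolding combinatorially_equivalent_def using bij by blast
qed

lemma on_face_hyperplane:
  "on_face p I (convex hull (p ` I) \<inter> {x. a \<bullet> x = b}) = {i \<in> I. a \<bullet> p i = b}"
  by (auto simp: on_face_def hull_inc)

lemma hull_le_iff:
  fixes p :: "'i \<Rightarrow> 'a::euclidean_space"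
  shows "convex hull (p ` I) \<subseteq> {x. a \<bullet> x \<le> b} \<longleftrightarrow> (\<forall>i\<in>I. a \<bullet> p i \<le> b)"
proof -
  have "convex {x. a \<bullet> x \<le> b}" by (simp add: convex_halfspace_le)
  then have "convex hull (p ` I) \<subseteq> {x. a \<bullet> x \<le> b} \<longleftrightarrow> p ` I \<subseteq> {x. a \<bullet> x \<le> b}"
    by (rule subset_hull)
  then show ?thesis by auto
qed

text \<open>
  This reduces statements about facets to linear inequalities at the vertices. It is the form
  in which facets are compared before and after a vertex is added.
\<close>

lemma facet_sets_iff:
  fixes p :: "'i \<Rightarrow> 'a::euclidean_space"
  assumes fin: "finite I" and full: "aff_dim (p ` I) = DIM('a)"
  shows "S \<in> facet_sets p I \<longleftrightarrow>
    (\<exists>a b. (\<forall>i\<in>I. a \<bullet> p i \<le> b) \<and> S = {i\<in>I. a \<bullet> p i = b} \<and> aff_dim (p ` S) = int DIM('a) - 1)"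
    (is "_ \<longleftrightarrow> ?R")
proof
  let ?P = "convex hull (p ` I)"
  assume "S \<in> facet_sets p I"
  then obtain F where F: "F facet_of ?P" "S = on_face p I F" by (auto simp: facet_sets_def)
  obtain a b where ab: "?P \<subseteq> {x. a \<bullet> x \<le> b}" "F = ?P \<inter> {x. a \<bullet> x = b}"
    using facet_of_polyhedron[OF polyhedron_hull_image[OF fin] F(1)] by metis
  have "F = convex hull (p ` S)"
    unfolding F(2) by (rule face_eq_hull_on_face[OF fin facet_of_imp_face_of[OF F(1)]])
  then have "aff_dim (p ` S) = int DIM('a) - 1"
    using F(1) full by (simp add: facet_of_def aff_dim_convex_hull)
  then show ?R using ab F(2) on_face_hyperplane hull_le_iff by metis
next
  let ?P = "convex hull (p ` I)"
  assume ?R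
  then obtain a b where ab: "\<forall>i\<in>I. a \<bullet> p i \<le> b" "S = {i\<in>I. a \<bullet> p i = b}"
    "aff_dim (p ` S) = int DIM('a) - 1" by blast
  define F where "F = ?P \<inter> {x. a \<bullet> x = b}"
  have F: "F face_of ?P"
    unfolding F_def using ab(1) hull_le_iff[of p I a b]
    by (intro face_of_Int_supporting_hyperplane_le) auto
  have S: "on_face p I F = S" unfolding F_def on_face_hyperplane ab(2) ..
  have FS: "F = convex hull (p ` S)" using face_eq_hull_on_face[OF fin F] S by simp
  have dim: "aff_dim F = int DIM('a) - 1" unfolding FS aff_dim_convex_hull by (rule ab(3))
  then have "F \<noteq> {}" using DIM_positive[where 'a='a] by auto
  then have "F facet_of ?P" using F dim full by (simp add: facet_of_def aff_dim_convex_hull)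
  then show "S \<in> facet_sets p I" using S by (auto simp: facet_sets_def)
qed

text \<open>
  Having \<open>D\<close> vertices that span dimension \<open>D - 1\<close>, such a facet is a simplex.
\<close>

lemma facet_sets_card:
  fixes p :: "'i \<Rightarrow> 'a::euclidean_space"
  assumes fin: "finite I" and full: "aff_dim (p ` I) = DIM('a)"
    and S: "S \<in> facet_sets p I" "card S = DIM('a)"
  shows "inj_on p S" and "\<not> affine_dependent (p ` S)"
    and "convex hull (p ` S) face_of (convex hull (p ` I))"
    and "on_face p I (convex hull (p ` S)) = S"
proof -
  have SI: "S \<subseteq> I" using S(1) by (auto simp: facet_sets_def on_face_def)
  then have finS: "finite S" using fin finite_subset by blast
  have d: "aff_dim (p ` S) = int DIM('a) - 1" using S(1) facet_sets_iff[OF fin full] by blast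
  have "aff_dim (p ` S) \<le> int (card (p ` S)) - 1" using finS by (intro aff_dim_le_card) simp
  then have c: "card (p ` S) = card S"
    using d S(2) card_image_le[OF finS, of p] by linarith
  then show "\<not> affine_dependent (p ` S)"
    using d S(2) finS by (simp add: affine_independent_iff_card)
  show "inj_on p S" using c finS eq_card_imp_inj_on by blast
  obtain F where F: "F facet_of (convex hull (p ` I))" "S = on_face p I F"
    using S(1) by (auto simp: facet_sets_def)
  have "F = convex hull (p ` S)"
    unfolding F(2) by (rule face_eq_hull_on_face[OF fin facet_of_imp_face_of[OF F(1)]])
  then show "convex hull (p ` S) face_of (convex hull (p ` I))"
    and "on_face p I (convex hull (p ` S)) = S"
    using F facet_of_imp_face_of by simp_all
qed

text \<open>
  Each point \<open>p i\<close> is a vertex of a facet that is a simplex, hence a vertex of the polytope.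
  Equal points lie on the same facets, and the points of a single facet are distinct.
\<close>

lemma vertices_eq_image:
  fixes p :: "'i \<Rightarrow> 'a::euclidean_space"
  assumes fin: "finite I" and full: "aff_dim (p ` I) = DIM('a)"
    and card: "\<And>S. S \<in> facet_sets p I \<Longrightarrow> card S = DIM('a)"
    and cover: "\<Union>(facet_sets p I) = I"
  shows "vertices (convex hull (p ` I)) = p ` I" and "inj_on p I"
proof -
  show "vertices (convex hull (p ` I)) = p ` I"
  proof
    show "vertices (convex hull (p ` I)) \<subseteq> p ` I"
      using extreme_point_of_convex_hull by (auto simp: vertices_def)
    show "p ` I \<subseteq> vertices (convex hull (p ` I))"
    proof clarify
      fix i assume "i \<in> I"
      then obtain S where S: "S \<in> facet_sets p I" "i \<in> S" using cover by blast
      have "p i extreme_point_of (convex hull (p ` S))"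
        using facet_sets_card[OF fin full S(1) card[OF S(1)]] S(2)
          extreme_point_of_convex_hull_affine_independent by blast
      then show "p i \<in> vertices (convex hull (p ` I))"
        using facet_sets_card[OF fin full S(1) card[OF S(1)]] extreme_point_of_face
        unfolding vertices_def by blast
    qed
  qed
  show "inj_on p I"
  proof (rule inj_onI)
    fix i j assume ij: "i \<in> I" "j \<in> I" "p i = p j"
    then obtain S where S: "S \<in> facet_sets p I" "i \<in> S" using cover by blast
    then have "j \<in> S" using ij by (auto simp: facet_sets_def on_face_def)
    then show "i = j" 
      using facet_sets_card[OF fin full S(1) card[OF S(1)]] S(2) ij(3) by (auto dest: inj_onD)
  qed
qed

lemma interior_strictly_beneath:
  fixes a :: "'a::euclidean_space"
  assumes "P \<subseteq> {x. a \<bullet> x \<le> b}" "a \<noteq> 0" "x \<in> interior P"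
  shows "a \<bullet> x < b"
  using interior_mono[OF assms(1)] assms(2,3) by auto

text \<open>
  The segment from an interior point \<open>z\<close> to a point \<open>y\<close> outside the interior meets the
  boundary, hence some facet; but both \<open>z\<close> and \<open>y\<close> are strictly beneath that facet.
\<close>

lemma interiorI_beneath:
  fixes P :: "'a::euclidean_space set"
  assumes "polytope P" "interior P \<noteq> {}"
    and ben: "\<And>F. F facet_of P \<Longrightarrow> beneath y F P"
  shows "y \<in> interior P"
proof (rule ccontr)
  assume y: "y \<notin> interior P"
  obtain z where z: "z \<in> interior P" using assms(2) by blast
  have full: "affine hull P = UNIV" using assms(2) affine_hull_nonempty_interior by blast
  have conv: "closed P" using assms(1) by (simp add: polytope_imp_closed)
  have "closed_segment z y \<inter> frontier (interior P) \<noteq> {}"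
    using y z by (intro connected_Int_frontier) auto
  then obtain w where w: "w \<in> closed_segment z y" "w \<in> frontier (interior P)" by blast
  have "w \<in> P - interior P"
    using w(2) closure_mono[OF interior_subset, of P] conv by (auto simp: frontier_def)
  then have "w \<in> P - rel_interior P" using rel_interior_interior[OF full] by simp
  then obtain F where F: "F facet_of P" "w \<in> F"
    using rel_boundary_of_polyhedron[OF polytope_imp_polyhedron[OF assms(1)]] by blast
  obtain a b where ab: "P \<subseteq> {x. a \<bullet> x \<le> b}" "F = P \<inter> {x. a \<bullet> x = b}" "a \<bullet> y < b"
    using ben[OF F(1)] unfolding beneath_def by blast
  have "z \<notin> F"
    using face_of_disjoint_interior[OF facet_of_imp_face_of[OF F(1)]] z F(1) facet_of_irrefl by blast
  then have "a \<bullet> z < b" using z interior_subset[of P] ab by force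
  then have "closed_segment z y \<subseteq> {x. a \<bullet> x < b}"
    using ab(3) by (intro closed_segment_subset) (auto simp: convex_halfspace_lt)
  then show False using w(1) F(2) ab(2) by auto
qed

lemma facet_sets_simplex:
  fixes p :: "'i \<Rightarrow> 'a::euclidean_space"
  assumes fin: "finite I" and inj: "inj_on p I" and ind: "\<not> affine_dependent (p ` I)"
    and card: "card I \<ge> 2"
  shows "facet_sets p I = (\<lambda>i. I - {i}) ` I"
proof -
  have im: "p ` I - {p i} = p ` (I - {i})" if "i \<in> I" for i
    using inj that by (auto simp: inj_on_def)
  have "I - {i} \<noteq> {}" for i
  proof
    assume "I - {i} = {}"
    then have "card I \<le> card {i}" by (intro card_mono) auto
    then show False using card by simp
  qed
  then have ne: "convex hull (p ` (I - {i})) \<noteq> {}" for i by simp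
  have "T facet_of convex hull (p ` I) \<longleftrightarrow> (\<exists>i\<in>I. T = convex hull (p ` (I - {i})))" for T
    unfolding facet_of_convex_hull_affine_independent[OF ind] using im ne by auto
  then have "facet_sets p I = (\<lambda>i. on_face p I (convex hull (p ` (I - {i})))) ` I"
    unfolding facet_sets_def by auto
  also have "\<dots> = (\<lambda>i. I - {i}) ` I"
  proof (rule image_cong[OF refl])
    fix i assume i: "i \<in> I"
    have "p i \<notin> affine hull (p ` (I - {i}))"
      using ind i im[OF i] unfolding affine_dependent_def by auto
    then have "p i \<notin> convex hull (p ` (I - {i}))"
      using convex_hull_subset_affine_hull by blast
    then show "on_face p I (convex hull (p ` (I - {i}))) = I - {i}"
      using i by (auto simp: on_face_def hull_inc)
  qed
  finally show ?thesis .
qed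

section \<open>Facets after stacking\<close>

lemma aff_dim_insert_off_hyperplane:
  fixes p :: "'i \<Rightarrow> 'a::euclidean_space"
  assumes "a \<bullet> v \<noteq> b" "\<And>i. i \<in> S \<Longrightarrow> a \<bullet> p i = b"
  shows "aff_dim (insert v (p ` S)) = aff_dim (p ` S) + 1"
proof -
  have "affine hull (p ` S) \<subseteq> {x. a \<bullet> x = b}"
    using assms(2) by (intro hull_minimal) (auto simp: affine_hyperplane)
  then have "v \<notin> affine hull (p ` S)" using assms(1) by blast
  then show ?thesis by (simp add: aff_dim_insert)
qed

text \<open>
  The ridge obtained from \<open>S\<close> by omitting \<open>i\<close> is an intersection of facets and is
  smaller than the facet \<open>S\<close>, so it lies on a second facet \<open>T\<close>. As \<open>T\<close> has no more vertices
  than \<open>S\<close>, the two share nothing but the ridge. The dimension is at least two because a ridge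
  of a segment is empty.
\<close>

lemma ex_adjacent_facet:
  fixes p :: "'i \<Rightarrow> 'a::euclidean_space"
  assumes fin: "finite I" and full: "aff_dim (p ` I) = DIM('a)" and dim: "DIM('a) \<ge> 2"
    and card: "\<And>S. S \<in> facet_sets p I \<Longrightarrow> card S = DIM('a)"
    and S: "S \<in> facet_sets p I" and i: "i \<in> S"
  obtains T where "T \<in> facet_sets p I" "S \<inter> T = S - {i}"
proof -
  let ?P = "convex hull (p ` I)" and ?R = "convex hull (p ` (S - {i}))"
  note SF = facet_sets_card[OF fin full S card[OF S]]
  have SI: "S \<subseteq> I" using S by (auto simp: facet_sets_def on_face_def)
  have finS: "finite S" using SI fin finite_subset by blast
  have "?R face_of convex hull (p ` S)"
    unfolding face_of_convex_hull_affine_independent[OF SF(2)]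
    by (intro exI[of _ "p ` (S - {i})"]) auto
  then have R: "?R face_of ?P" using SF(3) by (rule face_of_trans)
  have "S - {i} \<noteq> {}"
  proof
    assume "S - {i} = {}"
    then have "card S \<le> card {i}" by (intro card_mono) auto
    then show False using card[OF S] dim by simp
  qed
  then have ne: "?R \<noteq> {}" by simp
  have "\<not> affine_dependent (p ` (S - {i}))"
    by (rule affine_independent_subset[OF SF(2)]) auto
  then have "aff_dim ?R = int (card (p ` (S - {i}))) - 1"
    using affine_independent_iff_card aff_dim_convex_hull by metis
  also have "card (p ` (S - {i})) = card (S - {i})"
    using SF(1) by (intro card_image) (auto intro: inj_on_subset)
  also have "card (S - {i}) = DIM('a) - 1" using card[OF S] i finS by simp
  finally have Rdim: "aff_dim ?R = int DIM('a) - 2" using dim by (simp add: of_nat_diff)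
  then have "?R \<noteq> ?P" using full aff_dim_convex_hull[of "p ` I"] by auto
  then have RI: "?R = \<Inter>{F. F facet_of ?P \<and> ?R \<subseteq> F}"
    using face_of_polyhedron[OF polyhedron_hull_image[OF fin] R ne] by blast
  have "\<exists>G. G facet_of ?P \<and> ?R \<subseteq> G \<and> G \<noteq> convex hull (p ` S)"
  proof (rule ccontr)
    assume "\<nexists>G. G facet_of ?P \<and> ?R \<subseteq> G \<and> G \<noteq> convex hull (p ` S)"
    then have sub: "{F. F facet_of ?P \<and> ?R \<subseteq> F} \<subseteq> {convex hull (p ` S)}" by blast
    have "convex hull (p ` S) \<subseteq> \<Inter>{F. F facet_of ?P \<and> ?R \<subseteq> F}"
      using sub by blast
    then have "aff_dim (convex hull (p ` S)) \<le> aff_dim ?R" using RI aff_dim_subset by metis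
    moreover have "aff_dim (p ` S) = int DIM('a) - 1" using S facet_sets_iff[OF fin full] by blast
    ultimately show False using Rdim aff_dim_convex_hull[of "p ` S"] by linarith
  qed
  then obtain G where G: "G facet_of ?P" "?R \<subseteq> G" "G \<noteq> convex hull (p ` S)" by blast
  let ?T = "on_face p I G"
  have T: "?T \<in> facet_sets p I" using G by (auto simp: facet_sets_def)
  have "G = convex hull (p ` ?T)"
    by (rule face_eq_hull_on_face[OF fin facet_of_imp_face_of[OF G(1)]])
  then have "?T \<noteq> S" using G by metis
  have "S - {i} \<subseteq> ?T" using G(2) hull_subset[of "p ` (S - {i})" convex] SI by (auto simp: on_face_def)
  moreover have "i \<notin> ?T"
  proof
    assume "i \<in> ?T"
    then have "S \<subseteq> ?T" using \<open>S - {i} \<subseteq> ?T\<close> by blast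
    moreover have "finite ?T" using fin by (simp add: on_face_def)
    ultimately have "S = ?T" using card[OF T] card[OF S] card_subset_eq by metis
    then show False using \<open>?T \<noteq> S\<close> by simp
  qed
  ultimately have "S \<inter> ?T = S - {i}" by blast
  then show ?thesis using that T by blast
qed

text \<open>
  Facets other than \<open>S\<close> stay facets because the new vertex is strictly beneath them. The
  hyperplane of a new facet \<open>insert n (S - {i})\<close> is found in the pencil spanned by the
  hyperplanes of \<open>S\<close> and of its neighbour across the ridge \<open>S - {i}\<close>. Conversely, a facet
  through the new vertex contains no old vertex \<open>p j\<close> off \<open>S\<close>: points of the segment from
  \<open>p j\<close> to the new vertex that are close to \<open>p j\<close> are strictly beneath all facets of the old
  polytope, hence interior to it.
\<close>

lemma facet_sets_stack:
  fixes p :: "'i \<Rightarrow> 'a::euclidean_space"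
  assumes fin: "finite I" and full: "aff_dim (p ` I) = DIM('a)" and dim: "DIM('a) \<ge> 2"
    and card: "\<And>S. S \<in> facet_sets p I \<Longrightarrow> card S = DIM('a)"
    and S: "S \<in> facet_sets p I" and n: "n \<notin> I"
    and beyond: "beyond (p n) (convex hull (p ` S)) (convex hull (p ` I))"
    and beneath: "\<And>G. G facet_of (convex hull (p ` I)) \<Longrightarrow> G \<noteq> convex hull (p ` S)
      \<Longrightarrow> beneath (p n) G (convex hull (p ` I))"
  shows "facet_sets p (insert n I) = facet_sets p I - {S} \<union> (\<lambda>i. insert n (S - {i})) ` S"
    (is "_ = ?R")
proof -
  let ?P = "convex hull (p ` I)" and ?J = "insert n I"
  have finJ: "finite ?J" using fin by simp
  have fullJ: "aff_dim (p ` ?J) = DIM('a)"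
    using full aff_dim_subset[of "p ` I" "p ` ?J"] aff_dim_le_DIM[of "p ` ?J"] by force
  note SF = facet_sets_card[OF fin full S card[OF S]]
  have sub: "T \<subseteq> I" if "T \<in> facet_sets p I" for T
    using that by (auto simp: facet_sets_def on_face_def)
  have finS: "finite S" using sub[OF S] fin finite_subset by blast
  have nS: "n \<notin> S" using sub[OF S] n by blast
  have fdim: "aff_dim (p ` T) = int DIM('a) - 1" if "T \<in> facet_sets p I" for T
    using that facet_sets_iff[OF fin full] by blast
  have "affine hull ?P = UNIV" using full aff_dim_eq_full[of "p ` I"] by simp
  then have "rel_interior ?P = interior ?P" by (rule rel_interior_interior)
  moreover have "?P \<noteq> {}" using full by auto
  ultimately have int: "interior ?P \<noteq> {}" using rel_interior_eq_empty[of ?P] by simp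
  have poly: "polytope ?P" using fin by (intro polytope_convex_hull) simp
  obtain a0 b0 where ab0: "?P \<subseteq> {x. a0 \<bullet> x \<le> b0}" "convex hull (p ` S) = ?P \<inter> {x. a0 \<bullet> x = b0}"
     "a0 \<bullet> p n > b0"
    using beyond unfolding beyond_def by blast
  have le0: "a0 \<bullet> p i \<le> b0" if "i \<in> I" for i using ab0(1) that unfolding hull_le_iff by simp
  have eq0: "S = {i\<in>I. a0 \<bullet> p i = b0}" using SF(4) on_face_hyperplane[of p I a0 b0] ab0(2) by simp
  have ben: "\<exists>a b. (\<forall>i\<in>I. a \<bullet> p i \<le> b) \<and> T = {i\<in>I. a \<bullet> p i = b} \<and> a \<bullet> p n < b"
    if T: "T \<in> facet_sets p I" "T \<noteq> S" for T
  proof -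
    obtain G where G: "G facet_of ?P" "T = on_face p I G" using T(1) by (auto simp: facet_sets_def)
    then have "G \<noteq> convex hull (p ` S)" using T(2) SF(4) by auto
    then obtain a b where "?P \<subseteq> {x. a \<bullet> x \<le> b}" "G = ?P \<inter> {x. a \<bullet> x = b}" "a \<bullet> p n < b"
      using beneath[OF G(1)] unfolding beneath_def by blast
    then have "\<forall>i\<in>I. a \<bullet> p i \<le> b" "T = {i\<in>I. a \<bullet> p i = b}" "a \<bullet> p n < b"
      unfolding hull_le_iff G(2) using on_face_hyperplane[of p I a b] by simp_all
    then show ?thesis by blast
  qed
  show ?thesis
  proof
    show "?R \<subseteq> facet_sets p ?J"
    proof
      fix T assume "T \<in> ?R"
      then consider "T \<in> facet_sets p I" "T \<noteq> S" | i where "i \<in> S" "T = insert n (S - {i})" by blast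
      then show "T \<in> facet_sets p ?J"
      proof cases
        case 1
        then obtain a b where ab: "\<forall>i\<in>I. a \<bullet> p i \<le> b" "T = {i\<in>I. a \<bullet> p i = b}" "a \<bullet> p n < b"
          using ben by blast
        then have "(\<forall>i\<in>?J. a \<bullet> p i \<le> b) \<and> T = {i\<in>?J. a \<bullet> p i = b}" by auto
        then show ?thesis using facet_sets_iff[OF finJ fullJ] fdim[OF 1(1)] by blast
      next
        case 2
        obtain T' where T': "T' \<in> facet_sets p I" "S \<inter> T' = S - {i}"
          using ex_adjacent_facet[OF fin full dim card S 2(1)] by blast
        then have "T' \<noteq> S" using 2(1) by auto
        then obtain a b where ab: "\<forall>i\<in>I. a \<bullet> p i \<le> b" "T' = {i\<in>I. a \<bullet> p i = b}" "a \<bullet> p n < b"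
          using ben T' by blast
        \<comment> \<open>The coefficients are positive and chosen so that the combination vanishes at the new vertex.\<close>
        define s where "s = b - a \<bullet> p n"
        define t where "t = a0 \<bullet> p n - b0"
        have st: "s > 0" "t > 0" using ab(3) ab0(3) by (auto simp: s_def t_def)
        define c where "c = s *\<^sub>R a0 + t *\<^sub>R a"
        define d where "d = s * b0 + t * b"
        have cd: "c \<bullet> x - d = s * (a0 \<bullet> x - b0) + t * (a \<bullet> x - b)" for x
          by (simp add: c_def d_def inner_add_left algebra_simps)
        have nn: "c \<bullet> p n = d" using cd[of "p n"] by (simp add: s_def t_def algebra_simps)
        have I1: "c \<bullet> p j \<le> d \<and> (c \<bullet> p j = d \<longleftrightarrow> j \<in> S \<inter> T')" if "j \<in> I" for j
        proof -
          have 1: "s * (a0 \<bullet> p j - b0) \<le> 0" "t * (a \<bullet> p j - b) \<le> 0"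
            using st le0[OF that] ab(1) that by (simp_all add: mult_le_0_iff)
          have "c \<bullet> p j = d \<longleftrightarrow> s * (a0 \<bullet> p j - b0) = 0 \<and> t * (a \<bullet> p j - b) = 0"
            using 1 cd[of "p j"] by linarith
          also have "\<dots> \<longleftrightarrow> j \<in> S \<inter> T'" using st that eq0 ab(2) by auto
          finally show ?thesis using 1 cd[of "p j"] by linarith
        qed
        have TT: "T = {j\<in>?J. c \<bullet> p j = d}"
          using I1 nn T'(2) 2(2) sub[OF S] by blast
        have "\<not> affine_dependent (p ` (S - {i}))"
          by (rule affine_independent_subset[OF SF(2)]) auto
        then have "aff_dim (p ` (S - {i})) = int (card (p ` (S - {i}))) - 1"
          using affine_independent_iff_card by metis
        also have "card (p ` (S - {i})) = card (S - {i})"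
          using SF(1) by (intro card_image) (auto intro: inj_on_subset)
        also have "card (S - {i}) = DIM('a) - 1" using card[OF S] 2(1) finS by simp
        finally have Rdim: "aff_dim (p ` (S - {i})) = int DIM('a) - 2" using dim by (simp add: of_nat_diff)
        have "aff_dim (insert (p n) (p ` (S - {i}))) = aff_dim (p ` (S - {i})) + 1"
          using ab0(3) eq0 by (intro aff_dim_insert_off_hyperplane[of a0 _ b0]) auto
        then have "aff_dim (p ` T) = int DIM('a) - 1" using Rdim 2(2) by simp
        moreover have "\<forall>j\<in>?J. c \<bullet> p j \<le> d" using I1 nn by auto
        ultimately show ?thesis using TT facet_sets_iff[OF finJ fullJ] by blast
      qed
    qed
    show "facet_sets p ?J \<subseteq> ?R"
    proof
      fix T assume "T \<in> facet_sets p ?J"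
      then obtain a b where ab: "\<forall>i\<in>?J. a \<bullet> p i \<le> b" "T = {i\<in>?J. a \<bullet> p i = b}"
        "aff_dim (p ` T) = int DIM('a) - 1"
        using facet_sets_iff[OF finJ fullJ] by blast
      show "T \<in> ?R"
      proof (cases "n \<in> T")
        case False
        have an: "a \<bullet> p n < b" using ab(1,2) False by force
        have T1: "T = {i\<in>I. a \<bullet> p i = b}" using ab(2) an by auto
        have "T \<noteq> S"
        proof
          assume TS: "T = S"
          have hull: "?P \<subseteq> {x. a \<bullet> x \<le> b}" unfolding hull_le_iff using ab(1) by simp
          then have fc: "(?P \<inter> {x. a \<bullet> x = b}) face_of ?P"
            by (intro face_of_Int_supporting_hyperplane_le) auto
          have "?P \<inter> {x. a \<bullet> x = b} = convex hull (p ` S)"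
            using face_eq_hull_on_face[OF fin fc] on_face_hyperplane[of p I a b] T1 TS by simp
          then have "beneath (p n) (convex hull (p ` S)) ?P"
            unfolding beneath_def using hull an by blast
          then have "p n \<in> interior ?P" using beneath by (intro interiorI_beneath[OF poly int]) auto
          then have "p n \<in> {x. a0 \<bullet> x \<le> b0}" using ab0(1) interior_subset by blast
          then show False using ab0(3) by simp
        qed
        moreover have "T \<in> facet_sets p I"
          using T1 ab facet_sets_iff[OF fin full] by blast
        ultimately show ?thesis by blast
      next
        case True
        then have nb: "a \<bullet> p n = b" using ab(2) by blast
        have a0: "a \<noteq> 0"
        proof
          assume "a = 0"
          then have "T = ?J" using ab(2) nb by auto
          then show False using ab(3) fullJ by simp
        qed
        have TS: "T - {n} \<subseteq> S"
        proof
          fix j assume j: "j \<in> T - {n}"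
          show "j \<in> S"
          proof (rule ccontr)
            assume "j \<notin> S"
            have jI: "j \<in> I" and jb: "a \<bullet> p j = b" using j ab(2) by auto
            have "a0 \<bullet> p j < b0" using jI \<open>j \<notin> S\<close> eq0 le0 by force
            \<comment> \<open>With this \<open>t\<close> the point \<open>y\<close> below is still strictly beneath \<open>S\<close>, although \<open>p n\<close> is beyond it.\<close>
            define t where "t = ((b0 - a0 \<bullet> p j) / 2) / (a0 \<bullet> p n - a0 \<bullet> p j)"
            have pos: "b0 - a0 \<bullet> p j > 0" "a0 \<bullet> p n - a0 \<bullet> p j > b0 - a0 \<bullet> p j"
              using \<open>a0 \<bullet> p j < b0\<close> ab0(3) by auto
            have t: "t > 0" "t < 1" using pos by (auto simp: t_def field_simps)
            have cancel: "h / g * g = h" if "g \<noteq> 0" for g h :: real using that by simp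
            define y where "y = (1 - t) *\<^sub>R p j + t *\<^sub>R p n"
            have y: "c \<bullet> y = (1 - t) * (c \<bullet> p j) + t * (c \<bullet> p n)" for c
              by (simp add: y_def inner_add_right)
            have "a0 \<bullet> y = a0 \<bullet> p j + t * (a0 \<bullet> p n - a0 \<bullet> p j)"
              unfolding y by (simp add: algebra_simps)
            also have "t * (a0 \<bullet> p n - a0 \<bullet> p j) = (b0 - a0 \<bullet> p j) / 2"
              unfolding t_def by (rule cancel) (use pos in simp)
            finally have y0: "a0 \<bullet> y < b0" using pos(1) by argo
            have "y \<in> interior ?P"
            proof (rule interiorI_beneath[OF poly int])
              fix F assume F: "F facet_of ?P"
              show "beneath y F ?P"
              proof (cases "F = convex hull (p ` S)")
                case True
                then show ?thesis using ab0 y0 unfolding beneath_def by blast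
              next
                case False
                then obtain c d where cd: "?P \<subseteq> {x. c \<bullet> x \<le> d}" "F = ?P \<inter> {x. c \<bullet> x = d}" "c \<bullet> p n < d"
                  using beneath[OF F] unfolding beneath_def by blast
                have "c \<bullet> p j \<le> d" using cd(1) jI unfolding hull_le_iff by simp
                then have "(1 - t) * (c \<bullet> p j) \<le> (1 - t) * d" using t by simp
                moreover have "t * (c \<bullet> p n) < t * d" using t cd(3) by simp
                ultimately have "c \<bullet> y < d" unfolding y by (simp add: algebra_simps)
                then show ?thesis unfolding beneath_def using cd by blast
              qed
            qed
            then have "a \<bullet> y < b"
              by (intro interior_strictly_beneath[OF _ a0]) (use ab(1) in \<open>simp_all add: hull_le_iff\<close>)
            moreover have "a \<bullet> y = b" unfolding y nb jb by (simp add: algebra_simps)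
            ultimately show False by simp
          qed
        qed
        have Tn: "T = insert n (T - {n})" using True by blast
        then have pT: "p ` T = insert (p n) (p ` (T - {n}))" by (metis image_insert)
        \<comment> \<open>The vertex \<open>p n\<close> is off the hyperplane of \<open>S\<close>, so together they would span the whole space.\<close>
        have "T - {n} \<noteq> S"
        proof
          assume "T - {n} = S"
          then have "aff_dim (p ` T) = aff_dim (p ` S) + 1"
            unfolding pT using ab0(3) eq0 by (subst aff_dim_insert_off_hyperplane[of a0 _ b0]) auto
          then show False using fdim[OF S] ab(3) by simp
        qed
        then obtain i where i: "i \<in> S" "T - {n} \<subseteq> S - {i}" using TS by blast
        have finT: "finite T" using ab(2) fin by simp
        have "int DIM('a) - 1 \<le> int (card (p ` T)) - 1"
          using aff_dim_le_card[of "p ` T"] finT ab(3) by simp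
        then have "DIM('a) \<le> card T" using card_image_le[OF finT, of p] by linarith
        then have "card (S - {i}) \<le> card (T - {n})"
          using True finT i(1) finS card[OF S] by simp
        then have "T - {n} = S - {i}" using i(2) finS card_seteq[of "S - {i}"] by simp
        then show ?thesis using Tn i(1) by blast
      qed
    qed
  qed
qed

section \<open>Smooth and strictly convex bodies\<close>

lemma convex_bodyD:
  fixes K :: "'a::euclidean_space set"
  assumes "convex_body K"
  shows "convex K" "closed K" "interior K \<noteq> {}"
proof -
  show c: "convex K" "closed K" using assms by (auto simp: convex_body_def compact_imp_closed)
  have ne: "K \<noteq> {}" using assms by (auto simp: convex_body_def)
  have "affine hull K = UNIV" using assms by (simp add: convex_body_def aff_dim_eq_full)
  then show "interior K \<noteq> {}" 
    using rel_interior_interior rel_interior_eq_empty[OF c(1)] ne by blast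
qed

text \<open>
  If the ray in direction \<open>w\<close> avoided the interior, a hyperplane separating the two would
  support \<open>K\<close> at \<open>v\<close>. By smoothness it would be the tangent hyperplane, but the ray leaves that
  hyperplane towards the side of \<open>K\<close>.
\<close>

lemma smooth_body_ray_enters:
  fixes K :: "'a::euclidean_space set"
  assumes K: "convex_body K" "smooth_body K" and v: "v \<in> frontier K"
    and u: "u \<noteq> 0" "K \<subseteq> {x. u \<bullet> x \<le> u \<bullet> v}" and w: "u \<bullet> w < 0"
  obtains t where "t > 0" "v + t *\<^sub>R w \<in> interior K"
proof -
  note KD = convex_bodyD[OF K(1)]
  have vK: "v \<in> K" using v KD(2) frontier_subset_closed by blast
  have "\<exists>t>0. v + t *\<^sub>R w \<in> interior K"
  proof (rule ccontr)
    assume no: "\<not> (\<exists>t>0. v + t *\<^sub>R w \<in> interior K)"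
    define R where "R = (\<lambda>t. v + t *\<^sub>R w) ` {0<..}"
    have "R = (+) v ` (\<lambda>t. t *\<^sub>R w) ` {0<..}" unfolding R_def by auto
    moreover have "convex ((\<lambda>t. t *\<^sub>R w) ` {0<..})"
      by (intro convex_linear_image linear_scaleR_left) (rule convex_real_interval)
    ultimately have "convex R" by (metis convex_translation)
    moreover have "R \<noteq> {}" by (auto simp: R_def)
    moreover have "interior K \<inter> R = {}" using no by (auto simp: R_def)
    ultimately obtain a b where ab: "a \<noteq> 0" "\<forall>x\<in>interior K. a \<bullet> x \<le> b" "\<forall>x\<in>R. a \<bullet> x \<ge> b"
      using separating_hyperplane_sets[of "interior K" R] KD(1,3) by auto
    have "interior K \<subseteq> {x. a \<bullet> x \<le> b}" using ab(2) by blast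
    then have "closure (interior K) \<subseteq> {x. a \<bullet> x \<le> b}"
      by (intro closure_minimal) (auto simp: closed_halfspace_le)
    then have KH: "K \<subseteq> {x. a \<bullet> x \<le> b}"
      using convex_closure_interior[OF KD(1,3)] closure_subset by blast
    have ge: "b \<le> a \<bullet> v + t * (a \<bullet> w)" if "t > 0" for t
      using ab(3) that by (auto simp: R_def inner_add_right)
    have "((\<lambda>t. a \<bullet> v + t * (a \<bullet> w)) \<longlongrightarrow> a \<bullet> v + 0 * (a \<bullet> w)) (at_right 0)"
      by (intro tendsto_intros)
    moreover have "\<forall>\<^sub>F t in at_right 0. b \<le> a \<bullet> v + t * (a \<bullet> w)"
      using ge by (intro eventually_at_rightI[of 0 1]) auto
    ultimately have "b \<le> a \<bullet> v + 0 * (a \<bullet> w)"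
      by (intro tendsto_lowerbound) auto
    then have av: "a \<bullet> v = b" using KH vK by auto
    have aw: "a \<bullet> w \<ge> 0" using ge[of 1] av by simp
    have "supporting_hyperplane K v {y. a \<bullet> y = b}" "supporting_hyperplane K v {y. u \<bullet> y = u \<bullet> v}"
      unfolding supporting_hyperplane_def using ab(1) av KH u by blast+
    then have H: "{y. a \<bullet> y = b} = {y. u \<bullet> y = u \<bullet> v}"
      using K(2) v unfolding smooth_body_def by blast
    obtain z where z: "z \<in> interior K" using KD(3) by blast
    have uz: "u \<bullet> z < u \<bullet> v" using interior_strictly_beneath[OF u(2,1) z] .
    have az: "a \<bullet> z < b" using interior_strictly_beneath[OF KH ab(1) z] .
    \<comment> \<open>With this \<open>s\<close> the vector \<open>w - s *\<^sub>R (z - v)\<close> is parallel to the common hyperplane.\<close>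
    define s where "s = (u \<bullet> w) / (u \<bullet> (z - v))"
    have "u \<bullet> (z - v) < 0" using uz by (simp add: inner_diff_right)
    then have s: "s > 0" "s * (u \<bullet> (z - v)) = u \<bullet> w" using w by (auto simp: s_def divide_neg_neg)
    have "u \<bullet> (v + (w - s *\<^sub>R (z - v))) = u \<bullet> v"
      using s(2) by (simp add: inner_add_right inner_diff_right)
    then have "a \<bullet> (v + (w - s *\<^sub>R (z - v))) = b" using H by blast
    then have "a \<bullet> w = s * (a \<bullet> z - b)"
      using av by (simp add: inner_add_right inner_diff_right)
    moreover have "s * (a \<bullet> z - b) < 0" using s(1) az by (simp add: mult_pos_neg)
    ultimately show False using aw by simp
  qed
  then show ?thesis using that by blast
qed

text \<open>
  A second contact point would put a whole segment of \<open>K\<close> into the supporting hyperplane,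
  and thus into the boundary of \<open>K\<close>.
\<close>

lemma strictly_convex_support:
  fixes K :: "'a::euclidean_space set"
  assumes K: "convex_body K" "strictly_convex K" and v: "v \<in> frontier K"
    and u: "u \<noteq> 0" "K \<subseteq> {x. u \<bullet> x \<le> u \<bullet> v}" and x: "x \<in> K" "x \<noteq> v"
  shows "u \<bullet> x < u \<bullet> v"
proof (rule ccontr)
  assume "\<not> u \<bullet> x < u \<bullet> v"
  then have eq: "u \<bullet> x = u \<bullet> v" using u(2) x(1) by auto
  note KD = convex_bodyD[OF K(1)]
  have vK: "v \<in> K" using v KD(2) frontier_subset_closed by blast
  have "closed_segment x v \<subseteq> K" using closed_segment_subset[OF x(1) vK KD(1)] .
  moreover have "closed_segment x v \<subseteq> {y. u \<bullet> y = u \<bullet> v}"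
    using eq by (intro closed_segment_subset) (auto simp: convex_hyperplane)
  ultimately have "closed_segment x v \<subseteq> frontier K"
    using interior_strictly_beneath[OF u(2,1)] KD(2) by (fastforce simp: frontier_def)
  then show False using K(2) x(2) unfolding strictly_convex_def by blast
qed

lemma eventually_along_ray:
  fixes c :: "'g \<Rightarrow> 'a::euclidean_space"
  assumes fin: "finite A" and le: "\<And>g. g \<in> A \<Longrightarrow> c g \<bullet> v \<le> d g"
    and neg: "\<And>g. g \<in> A \<Longrightarrow> c g \<bullet> v = d g \<Longrightarrow> c g \<bullet> w < 0"
  shows "\<forall>\<^sub>F t in at_right 0. \<forall>g\<in>A. c g \<bullet> (v + t *\<^sub>R w) < d g"
proof (rule eventually_ball_finite[OF fin], rule ballI)
  fix g assume g: "g \<in> A"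
  show "\<forall>\<^sub>F t in at_right 0. c g \<bullet> (v + t *\<^sub>R w) < d g"
  proof (cases "c g \<bullet> v = d g")
    case True
    then show ?thesis using neg[OF g]
      by (intro eventually_at_rightI[of 0 1]) (auto simp: inner_add_right mult_pos_neg)
  next
    case False
    have "((\<lambda>t. c g \<bullet> (v + t *\<^sub>R w)) \<longlongrightarrow> c g \<bullet> (v + 0 *\<^sub>R w)) (at_right 0)"
      by (intro tendsto_intros)
    then show ?thesis using False le[OF g] by (intro order_tendstoD(2)) auto
  qed
qed

text \<open>
  The inequalities \<open>c g \<bullet> x < d g\<close> describe an open convex region that is entered when leaving
  \<open>v\<close> in the tangent direction \<open>w\<close>. This remains true of directions tilted slightly inwards or
  outwards from \<open>w\<close>. The inward ray enters the interior of \<open>K\<close>, the outward one leaves \<open>K\<close>, so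
  a short segment between the two rays crosses the boundary inside the region.
\<close>

lemma frontier_point_in_cone:
  fixes K :: "'a::euclidean_space set" and c :: "'g \<Rightarrow> 'a"
  assumes K: "convex_body K" "smooth_body K" and v: "v \<in> frontier K"
    and u: "u \<noteq> 0" "K \<subseteq> {x. u \<bullet> x \<le> u \<bullet> v}" and w: "u \<bullet> w = 0"
    and fin: "finite A" and le: "\<And>g. g \<in> A \<Longrightarrow> c g \<bullet> v \<le> d g"
    and neg: "\<And>g. g \<in> A \<Longrightarrow> c g \<bullet> v = d g \<Longrightarrow> c g \<bullet> w < 0"
  obtains x where "x \<in> frontier K" "\<And>g. g \<in> A \<Longrightarrow> c g \<bullet> x < d g"
proof -
  note KD = convex_bodyD[OF K(1)]
  have vK: "v \<in> K" using v KD(2) frontier_subset_closed by blast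
  let ?B = "{g \<in> A. c g \<bullet> v = d g}"
  have tilt: "\<forall>\<^sub>F e in at_right 0. \<forall>g\<in>?B. c g \<bullet> (w + e *\<^sub>R y) < 0" for y
    using eventually_along_ray[of ?B c w "\<lambda>_. 0" y] fin neg by force
  have "\<forall>\<^sub>F e in at_right 0. (\<forall>g\<in>?B. c g \<bullet> (w + e *\<^sub>R u) < 0) \<and>
      (\<forall>g\<in>?B. c g \<bullet> (w + e *\<^sub>R (- u)) < 0) \<and> e > (0::real)"
    by (intro eventually_conj tilt eventually_at_right_less)
  then obtain e where e: "\<forall>g\<in>?B. c g \<bullet> (w + e *\<^sub>R u) < 0" "\<forall>g\<in>?B. c g \<bullet> (w + e *\<^sub>R (- u)) < 0" "e > 0"
    using eventually_happens'[OF trivial_limit_at_right_real] by blast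
  define w1 where "w1 = w + e *\<^sub>R u"
  define w2 where "w2 = w + e *\<^sub>R (- u)"
  have uw: "u \<bullet> w1 > 0" "u \<bullet> w2 < 0"
    using w u(1) e(3) by (auto simp: w1_def w2_def inner_add_right inner_diff_right)
  obtain t0 where t0: "t0 > 0" "v + t0 *\<^sub>R w2 \<in> interior K"
    using smooth_body_ray_enters[OF K v u uw(2)] by blast
  have ent: "v + t *\<^sub>R w2 \<in> interior K" if "t \<in> {0<..<t0}" for t
  proof -
    have "v - (t / t0) *\<^sub>R (v - (v + t0 *\<^sub>R w2)) \<in> interior K"
      using that t0 KD(1) vK by (intro mem_interior_convex_shrink) auto
    then show ?thesis using t0(1) by simp
  qed
  have "\<forall>\<^sub>F t in at_right 0. (\<forall>g\<in>A. c g \<bullet> (v + t *\<^sub>R w1) < d g) \<and>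
      (\<forall>g\<in>A. c g \<bullet> (v + t *\<^sub>R w2) < d g) \<and> v + t *\<^sub>R w2 \<in> interior K \<and> t > (0::real)"
    using e le t0(1) ent
    by (intro eventually_conj eventually_along_ray fin eventually_at_right_less
        eventually_at_rightI[of 0 t0 "\<lambda>t. v + t *\<^sub>R w2 \<in> interior K"]) (auto simp: w1_def w2_def)
  then obtain t where t: "\<forall>g\<in>A. c g \<bullet> (v + t *\<^sub>R w1) < d g"
      "\<forall>g\<in>A. c g \<bullet> (v + t *\<^sub>R w2) < d g" "v + t *\<^sub>R w2 \<in> interior K" "t > 0"
    using eventually_happens'[OF trivial_limit_at_right_real] by blast
  let ?L = "closed_segment (v + t *\<^sub>R w2) (v + t *\<^sub>R w1)"
  have "v + t *\<^sub>R w1 \<notin> K"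
  proof
    assume "v + t *\<^sub>R w1 \<in> K"
    then have "u \<bullet> (v + t *\<^sub>R w1) \<le> u \<bullet> v" using u(2) by blast
    then show False using uw(1) t(4) by (simp add: inner_add_right mult_le_0_iff)
  qed
  then have "?L \<inter> frontier K \<noteq> {}"
    using t(3) interior_subset[of K] by (intro connected_Int_frontier) auto
  then obtain x where x: "x \<in> ?L" "x \<in> frontier K" by blast
  moreover have "c g \<bullet> x < d g" if "g \<in> A" for g
  proof -
    have "?L \<subseteq> {x. c g \<bullet> x < d g}"
      using t(1,2) that by (intro closed_segment_subset) (auto simp: convex_halfspace_lt)
    then show ?thesis using x by blast
  qed
  ultimately show ?thesis using that by blast
qed

text \<open>
  Extreme points lie on the boundary, and by the Krein-Milman theorem they affinely span the
  space, so an affine basis can be chosen among them.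
\<close>

lemma ex_inscribed_simplex:
  fixes K :: "'a::euclidean_space set"
  assumes "convex_body K"
  obtains p :: "nat \<Rightarrow> 'a" where "p ` {..DIM('a)} \<subseteq> frontier K" "inj_on p {..DIM('a)}"
    "\<not> affine_dependent (p ` {..DIM('a)})"
proof -
  let ?E = "{x. x extreme_point_of K}"
  have K: "compact K" "convex K" "aff_dim K = DIM('a)" using assms by (auto simp: convex_body_def)
  have "aff_dim (convex hull ?E) = DIM('a)" using Krein_Milman_Minkowski[OF K(1,2)] K(3) by simp
  then have E: "aff_dim ?E = DIM('a)" by (simp add: aff_dim_convex_hull)
  have EK: "?E \<subseteq> frontier K"
    using closure_subset[of K] extreme_point_not_in_interior[of _ K]
    by (auto simp: frontier_def extreme_point_of_def)
  obtain B where B: "B \<subseteq> ?E" "\<not> affine_dependent B" "affine hull ?E = affine hull B"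
    using affine_basis_exists[of ?E] by blast
  have finB: "finite B" using B(2) by (rule aff_independent_finite)
  have "aff_dim B = DIM('a)" using B(3) E by (metis aff_dim_affine_hull)
  then have "card B = card {..DIM('a)}" using B(2) by (simp add: affine_independent_iff_card)
  then obtain p where "bij_betw p {..DIM('a)} B"
    using finB by (metis finite_atMost finite_same_card_bij)
  then show ?thesis using that[of p] B EK by (auto simp: bij_betw_def)
qed

text \<open>
  Some body is needed on which to realize the polytope \<open>P\<close> itself. For the ball, uniqueness of
  the supporting hyperplane is the equality case of the Cauchy-Schwarz inequality, and strict
  convexity is the parallelogram law.
\<close>

lemma cball_smooth_strictly_convex:
  "convex_body (cball 0 1 :: 'a::euclidean_space set)"
  "smooth_body (cball 0 1 :: 'a::euclidean_space set)"
  "strictly_convex (cball 0 1 :: 'a::euclidean_space set)"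
proof -
  let ?K = "cball 0 1 :: 'a set"
  show "convex_body ?K"
    by (auto simp: convex_body_def intro!: aff_dim_nonempty_interior)
  have "\<exists>!H. supporting_hyperplane ?K x H" if "norm x = 1" for x :: 'a
  proof
    have "x \<bullet> y \<le> 1" if "norm y \<le> 1" for y
      using norm_cauchy_schwarz[of x y] that \<open>norm x = 1\<close> by simp
    then show "supporting_hyperplane ?K x {y. x \<bullet> y = 1}"
      unfolding supporting_hyperplane_def using that
      by (intro exI[of _ x] exI[of _ 1]) (auto simp: dot_square_norm)
  next
    fix H assume "supporting_hyperplane ?K x H"
    then obtain a b where ab: "a \<noteq> 0" "H = {y. a \<bullet> y = b}" "a \<bullet> x = b" "?K \<subseteq> {y. a \<bullet> y \<le> b}"
      unfolding supporting_hyperplane_def by blast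
    have "(1 / norm a) *\<^sub>R a \<in> ?K" using ab(1) by simp
    then have "a \<bullet> ((1 / norm a) *\<^sub>R a) \<le> b" using ab(4) by blast
    then have "norm a \<le> a \<bullet> x" using ab(1,3) by (simp add: dot_square_norm power2_eq_square)
    then have "a \<bullet> x = norm a * norm x" using norm_cauchy_schwarz[of a x] that by simp
    then have ax: "a = norm a *\<^sub>R x" using norm_cauchy_schwarz_eq[of a x] that by simp
    have "b = norm a" using ab(3) \<open>a \<bullet> x = norm a * norm x\<close> that by simp
    moreover have "a \<bullet> y = norm a * (x \<bullet> y)" for y by (subst ax) simp
    ultimately show "H = {y. x \<bullet> y = 1}" using ab(1,2) by simp
  qed
  then show "smooth_body ?K" unfolding smooth_body_def by simp
  show "strictly_convex ?K" unfolding strictly_convex_def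
  proof (intro allI impI notI)
    fix x y :: 'a assume xy: "x \<noteq> y" and sub: "closed_segment x y \<subseteq> frontier ?K"
    then have "norm x = 1" "norm y = 1" by (auto simp: subset_iff)
    moreover have "norm (midpoint x y) = 1" using subsetD[OF sub midpoint_in_closed_segment] by simp
    then have "norm (x + y) = 2" by (simp add: midpoint_def)
    moreover have "(norm (x - y))\<^sup>2 = 2 * (norm x)\<^sup>2 + 2 * (norm y)\<^sup>2 - (norm (x + y))\<^sup>2"
      by (simp add: power2_norm_eq_inner inner_simps inner_commute)
    ultimately have "(norm (x - y))\<^sup>2 = 0" by simp
    then show False using xy by simp
  qed
qed

section \<open>The inscribed stacked polytopes\<close>

text \<open>
  The index sets of the facets after \<open>k\<close> stackings. The last simplex has vertices
  \<open>k, \<dots>, k + d\<close>, and vertex \<open>k + d + 1\<close> is stacked onto its facet opposite to \<open>k\<close>.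
\<close>

primrec stacking_family :: "nat \<Rightarrow> nat \<Rightarrow> nat set set" where
  "stacking_family d 0 = (\<lambda>i. {..d} - {i}) ` {..d}"
| "stacking_family d (Suc k) = stacking_family d k - {{Suc k..k + d}} \<union>
     (\<lambda>i. insert (Suc (k + d)) ({Suc k..k + d} - {i})) ` {Suc k..k + d}"

lemma stacking_family_subset_card:
  assumes "S \<in> stacking_family d k"
  shows "S \<subseteq> {..k + d} \<and> card S = d"
  using assms
proof (induction k arbitrary: S)
  case 0
  then show ?case by auto
next
  case (Suc k)
  then consider "S \<in> stacking_family d k"
    | i where "i \<in> {Suc k..k + d}" "S = insert (Suc (k + d)) ({Suc k..k + d} - {i})" by auto
  then show ?case
  proof cases
    case 1
    then show ?thesis using Suc.IH[of S] by auto
  next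
    case 2
    then show ?thesis by auto
  qed
qed

text \<open>
  The facets at the newest vertex are exactly those of the last simplex. This is what allows
  the signs at that vertex to be prescribed freely in the next stacking.
\<close>

lemma stacking_family_last:
  "{S \<in> stacking_family d k. k + d \<in> S} = (\<lambda>i. {k..k + d} - {i}) ` {k..<k + d}"
proof (cases k)
  case 0
  have "{S \<in> (\<lambda>i. {..d} - {i}) ` {..d}. d \<in> S} = (\<lambda>i. {..d} - {i}) ` {i \<in> {..d}. d \<in> {..d} - {i}}"
    by blast
  also have "{i \<in> {..d}. d \<in> {..d} - {i}} = {..<d}" by auto
  finally show ?thesis using 0 by (simp add: atLeast0AtMost lessThan_atLeast0)
next
  case (Suc m)
  have "S \<notin> stacking_family d m" if "k + d \<in> S" for S
  proof
    assume "S \<in> stacking_family d m"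
    then have "k + d \<in> {..m + d}" using stacking_family_subset_card that by blast
    then show False using Suc by simp
  qed
  then have "{S \<in> stacking_family d k. k + d \<in> S} =
      (\<lambda>i. insert (Suc (m + d)) ({Suc m..m + d} - {i})) ` {Suc m..m + d}"
    unfolding Suc stacking_family.simps by auto
  also have "\<dots> = (\<lambda>i. {k..k + d} - {i}) ` {Suc m..m + d}"
    using Suc by (intro image_cong refl) auto
  also have "{Suc m..m + d} = {k..<k + d}" using Suc by auto
  finally show ?thesis .
qed

lemma Union_stacking_family:
  assumes "d \<ge> 2"
  shows "\<Union>(stacking_family d k) = {..k + d}"
proof (induction k)
  case 0
  have "x \<in> \<Union>(stacking_family d 0)" if "x \<le> d" for x
  proof -
    have "(if x = 0 then 1 else 0) \<in> {..d} \<and> x \<noteq> (if x = 0 then 1 else 0)" using assms by auto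
    then show ?thesis using that by auto
  qed
  moreover have "\<Union>(stacking_family d 0) \<subseteq> {..d}" by auto
  ultimately show ?case by auto
next
  case (Suc k)
  show ?case
  proof
    show "\<Union>(stacking_family d (Suc k)) \<subseteq> {..Suc k + d}"
      using stacking_family_subset_card by blast
    show "{..Suc k + d} \<subseteq> \<Union>(stacking_family d (Suc k))"
    proof
      fix x assume x: "x \<in> {..Suc k + d}"
      show "x \<in> \<Union>(stacking_family d (Suc k))"
      proof (cases "x \<in> {Suc k..Suc k + d}")
        case True
        define i where "i = (if x = Suc k then Suc (Suc k) else Suc k)"
        have "i \<in> {Suc k..k + d}" "i \<noteq> x" using assms by (auto simp: i_def)
        then have "insert (Suc (k + d)) ({Suc k..k + d} - {i}) \<in> stacking_family d (Suc k)"
          "x \<in> insert (Suc (k + d)) ({Suc k..k + d} - {i})"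
          using True by auto
        then show ?thesis by blast
      next
        case False
        then have "x \<in> {..k + d}" using x by auto
        then obtain S where "S \<in> stacking_family d k" "x \<in> S" using Suc.IH by blast
        moreover have "S \<noteq> {Suc k..k + d}" using False \<open>x \<in> S\<close> by auto
        ultimately show ?thesis by auto
      qed
    qed
  qed
qed

text \<open>
  In the induction step the new vertex is sought near the newest vertex \<open>v\<close>. For \<open>j\<close> in
  \<open>{k..<k + D}\<close>, the facet at \<open>v\<close> opposite to \<open>p j\<close> contains all the edge directions
  \<open>p i - v\<close> except \<open>p j - v\<close>, which points inwards. Hence a combination of the edge directions is
  beyond that facet if its coefficient at \<open>j\<close> is negative, and beneath it if it is positive. In
  \<open>w\<close> only the coefficient at \<open>k\<close> is negative. Its size \<open>m\<close> is chosen so that \<open>w\<close> is tangent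
  to \<open>K\<close>, and \<open>m > 0\<close> because all the edges lie strictly on the same side of the tangent
  hyperplane.
\<close>

lemma ex_inscribed_stacking:
  fixes K :: "'a::euclidean_space set"
  assumes dim: "DIM('a) \<ge> 2" and K: "convex_body K" "smooth_body K" "strictly_convex K"
  shows "\<exists>p :: nat \<Rightarrow> 'a. p ` {..k + DIM('a)} \<subseteq> frontier K \<and>
    aff_dim (p ` {..k + DIM('a)}) = DIM('a) \<and>
    facet_sets p {..k + DIM('a)} = stacking_family DIM('a) k \<and>
    stacked_polytope DIM('a) (convex hull (p ` {..k + DIM('a)}))"
proof (induction k)
  case 0
  obtain p :: "nat \<Rightarrow> 'a" where p: "p ` {..DIM('a)} \<subseteq> frontier K" "inj_on p {..DIM('a)}"
    "\<not> affine_dependent (p ` {..DIM('a)})"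
    using ex_inscribed_simplex[OF K(1)] by blast
  have c: "card (p ` {..DIM('a)}) = DIM('a) + 1" using card_image[OF p(2)] by simp
  then have "aff_dim (p ` {..DIM('a)}) = DIM('a)"
    using p(3) by (simp add: affine_independent_iff_card)
  moreover have "facet_sets p {..DIM('a)} = stacking_family DIM('a) 0"
    using facet_sets_simplex[OF _ p(2,3)] dim by simp
  moreover have "int DIM('a) simplex (convex hull (p ` {..DIM('a)}))"
    unfolding simplex_def using p(3) c by (intro exI[of _ "p ` {..DIM('a)}"]) simp
  then have "stacked_polytope DIM('a) (convex hull (p ` {..DIM('a)}))" 
    by (rule stacked_polytope.simplex)
  ultimately show ?case using p(1) by (intro exI[of _ p]) simp
next
  case (Suc k)
  let ?d = "DIM('a)" and ?I = "{..k + DIM('a)}"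
  obtain p :: "nat \<Rightarrow> 'a" where p: "p ` ?I \<subseteq> frontier K" and full: "aff_dim (p ` ?I) = ?d"
    and fam: "facet_sets p ?I = stacking_family ?d k" 
    and st: "stacked_polytope ?d (convex hull (p ` ?I))"
    using Suc.IH by blast
  let ?P = "convex hull (p ` ?I)" and ?S = "{Suc k..k + ?d}"
  have fin: "finite ?I" by simp
  have card: "card S = ?d" if "S \<in> facet_sets p ?I" for S
    using that fam stacking_family_subset_card by blast
  have cover: "\<Union>(facet_sets p ?I) = ?I" using fam Union_stacking_family[OF dim] by simp
  have inj: "inj_on p ?I" by (rule vertices_eq_image(2)[OF fin full card cover])
  define v where "v = p (k + ?d)"
  have v: "v \<in> frontier K" using p by (auto simp: v_def)
  obtain u where u: "u \<noteq> 0" "K \<subseteq> {x. u \<bullet> x \<le> u \<bullet> v}"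
    using K(2) v unfolding smooth_body_def supporting_hyperplane_def by blast
  have ulow: "u \<bullet> (p i - v) < 0" if "i < k + ?d" for i
  proof -
    have "p i \<noteq> v" using inj that unfolding v_def by (auto dest: inj_onD)
    moreover have "p i \<in> p ` ?I" using that by simp
    then have "p i \<in> K" using p frontier_subset_closed[OF convex_bodyD(2)[OF K(1)]] by blast
    ultimately have "u \<bullet> p i < u \<bullet> v"
      using strictly_convex_support[OF K(1,3) v u] by blast
    then show ?thesis by (simp add: inner_diff_right)
  qed
  have "?S = {k..k + ?d} - {k}" by auto
  then have "?S \<in> (\<lambda>i. {k..k + ?d} - {i}) ` {k..<k + ?d}"
    by (intro image_eqI[of _ _ k]) auto
  then have S: "?S \<in> facet_sets p ?I" using stacking_family_last[of ?d k] fam by blast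
  note SF = facet_sets_card[OF fin full S card[OF S]]
  define F where "F = convex hull (p ` ?S)"
  obtain F' where F': "F' facet_of ?P" "?S = on_face p ?I F'" using S by (auto simp: facet_sets_def)
  have "F' = F" unfolding F_def F'(2)
    by (rule face_eq_hull_on_face[OF fin facet_of_imp_face_of[OF F'(1)]])
  then have F: "F facet_of ?P" using F' by simp
  have "\<exists>a b. ?P \<subseteq> {x. a \<bullet> x \<le> b} \<and> G = ?P \<inter> {x. a \<bullet> x = b}" if "G facet_of ?P" for G
    using facet_of_polyhedron[OF polyhedron_hull_image[OF fin] that] by metis
  then obtain a b where ab: "\<And>G. G facet_of ?P \<Longrightarrow> ?P \<subseteq> {x. a G \<bullet> x \<le> b G} \<and> G = ?P \<inter> {x. a G \<bullet> x = b G}"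
    by metis
  define m where "m = (\<Sum>j\<in>{Suc k..<k + ?d}. u \<bullet> (p j - v)) / (u \<bullet> (p k - v))"
  define w where "w = (\<Sum>j\<in>{Suc k..<k + ?d}. p j - v) - m *\<^sub>R (p k - v)"
  have uk: "u \<bullet> (p k - v) < 0" using ulow[of k] dim by simp
  \<comment> \<open>The sum is nonempty because the dimension is at least two.\<close>
  have "(\<Sum>j\<in>{Suc k..<k + ?d}. u \<bullet> (p j - v)) < (\<Sum>j\<in>{Suc k..<k + ?d}. 0)"
    using dim ulow by (intro sum_strict_mono) auto
  then have m: "m > 0" unfolding m_def using uk by (simp add: divide_neg_neg)
  have uw: "u \<bullet> w = 0" using uk by (simp add: w_def m_def inner_diff_right[of u "sum _ _"] inner_sum_right)
  have dir: "if G = F then a G \<bullet> w > 0 else a G \<bullet> w < 0"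
    if G: "G facet_of ?P" and vG: "a G \<bullet> v = b G" for G
  proof -
    let ?T = "on_face p ?I G"
    have le: "a G \<bullet> p j \<le> b G" if "j \<in> ?I" for j
      using ab[OF G] that unfolding hull_le_iff by simp
    have T: "?T = {j\<in>?I. a G \<bullet> p j = b G}" using on_face_hyperplane[of p ?I "a G" "b G"] ab[OF G] by simp
    have "?T \<in> stacking_family ?d k" using G fam by (auto simp: facet_sets_def)
    moreover have "k + ?d \<in> ?T" using T vG by (simp add: v_def)
    ultimately have "?T \<in> (\<lambda>i. {k..k + ?d} - {i}) ` {k..<k + ?d}"
      using stacking_family_last[of ?d k] by blast
    then obtain i where i: "i \<in> {k..<k + ?d}" "?T = {k..k + ?d} - {i}" by blast
    have zero: "a G \<bullet> (p j - v) = 0" if "j \<in> {k..k + ?d}" "j \<noteq> i" for j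
    proof -
      have "j \<in> ?T" using i that by blast
      then show ?thesis using T vG by (simp add: inner_diff_right)
    qed
    have neg: "a G \<bullet> (p i - v) < 0"
    proof -
      have "i \<notin> ?T" using i by blast
      then have "a G \<bullet> p i \<noteq> b G" using T i(1) by auto
      then show ?thesis using le[of i] i(1) vG by (simp add: inner_diff_right)
    qed
    have aw: "a G \<bullet> w = (\<Sum>j\<in>{Suc k..<k + ?d}. a G \<bullet> (p j - v)) - m * (a G \<bullet> (p k - v))"
      by (simp add: w_def inner_diff_right[of "a G" "sum _ _"] inner_sum_right)
    have Gh: "G = convex hull (p ` ?T)"
      by (rule face_eq_hull_on_face[OF fin facet_of_imp_face_of[OF G]])
    show ?thesis
    proof (cases "i = k")
      case True
      have "?T = ?S" unfolding i(2) True by auto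
      then have "G = F" using Gh F_def by simp
      moreover have "(\<Sum>j\<in>{Suc k..<k + ?d}. a G \<bullet> (p j - v)) = 0"
        using zero True by (intro sum.neutral) auto
      moreover have "m * (a G \<bullet> (p k - v)) < 0" using m neg True by (simp add: mult_pos_neg)
      ultimately show ?thesis using aw by simp
    next
      case False
      have "k \<in> ?T" unfolding i(2) using False by simp
      then have "?T \<noteq> ?S" by auto
      then have "G \<noteq> F" using F' \<open>F' = F\<close> by auto
      moreover have "(\<Sum>j\<in>{Suc k..<k + ?d}. a G \<bullet> (p j - v)) = a G \<bullet> (p i - v)"
        using zero False i(1) by (subst sum.remove[of _ i]) (auto intro!: sum.neutral)
      moreover have "a G \<bullet> (p k - v) = 0" using zero[of k] False by simp
      ultimately show ?thesis using aw neg by simp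
    qed
  qed
  \<comment> \<open>Reversing the inequality of \<open>F\<close> turns being beyond \<open>F\<close> into an upper bound like the others.\<close>
  define c where "c G = (if G = F then - a G else a G)" for G
  define e where "e G = (if G = F then - b G else b G)" for G
  have vP: "v \<in> ?P" unfolding v_def by (intro hull_inc) simp
  have vF: "v \<in> F" unfolding v_def F_def using dim by (intro hull_inc) simp
  have vFeq: "a F \<bullet> v = b F" using ab[OF F] vF by blast
  have finF: "finite {G. G facet_of ?P}"
    by (intro finite_polytope_facets polytope_convex_hull) simp
  have cle: "c G \<bullet> v \<le> e G" if "G \<in> {G. G facet_of ?P}" for G
    using ab[of G] that vP vFeq by (auto simp: c_def e_def)
  have cneg: "c G \<bullet> w < 0" if "G \<in> {G. G facet_of ?P}" "c G \<bullet> v = e G" for G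
    using dir[of G] that by (cases "G = F") (simp_all add: c_def e_def)
  obtain x where x: "x \<in> frontier K" "\<And>G. G \<in> {G. G facet_of ?P} \<Longrightarrow> c G \<bullet> x < e G"
    by (rule frontier_point_in_cone[OF K(1,2) v u uw finF, of c e]) (use cle cneg in blast)+
  have "a F \<bullet> x > b F" using x(2)[of F] F by (simp add: c_def e_def)
  then have bey: "beyond x F ?P" unfolding beyond_def using ab[OF F] by blast
  have ben: "beneath x G ?P" if "G facet_of ?P" "G \<noteq> F" for G
  proof -
    have "a G \<bullet> x < b G" using x(2)[of G] that by (simp add: c_def e_def)
    then show ?thesis unfolding beneath_def using ab[OF that(1)] by blast
  qed
  define n where "n = Suc (k + ?d)"
  define q where "q = p(n := x)"
  have nI: "n \<notin> ?I" by (simp add: n_def)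
  have qp: "q i = p i" if "i \<in> ?I" for i using that nI by (auto simp: q_def)
  have qn: "q n = x" by (simp add: q_def)
  have qI: "q ` ?I = p ` ?I" using qp by (intro image_cong refl)
  have qS: "q ` ?S = p ` ?S" using qp by (intro image_cong refl) simp
  have qf: "facet_sets q ?I = facet_sets p ?I"
    unfolding facet_sets_def qI using qp by (intro image_cong refl) (auto simp: on_face_def)
  have In: "insert n ?I = {..Suc k + ?d}" by (auto simp: n_def)
  have img: "q ` {..Suc k + ?d} = insert x (p ` ?I)" unfolding In[symmetric] using qI qn by simp
  have "facet_sets q (insert n ?I) = facet_sets q ?I - {?S} \<union> (\<lambda>i. insert n (?S - {i})) ` ?S"
    using full card S bey ben by (intro facet_sets_stack fin dim nI) (simp_all add: qI qS qf qn F_def)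
  then have 1: "facet_sets q {..Suc k + ?d} = stacking_family ?d (Suc k)"
    unfolding In qf fam by (simp add: n_def)
  have "affine hull ?P = UNIV" using full by (simp add: aff_dim_eq_full)
  then have "stacked_polytope ?d (convex hull (insert x ?P))"
    using stacked_polytope.stack[OF st F _ bey ben] by blast
  then have 2: "stacked_polytope ?d (convex hull (q ` {..Suc k + ?d}))"
    unfolding img by (simp add: hull_insert[of convex x "p ` ?I"])
  have "aff_dim (p ` ?I) \<le> aff_dim (insert x (p ` ?I))" by (intro aff_dim_subset) blast
  then have 3: "aff_dim (q ` {..Suc k + ?d}) = ?d"
    unfolding img using full aff_dim_le_DIM[of "insert x (p ` ?I)"] by linarith
  show ?case using 1 2 3 p x(1) img by (intro exI[of _ q]) simp
qed

theorem mainTheorem5: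
  fixes N :: nat
  assumes "CARD('n::finite) \<ge> 2"
    and "N \<ge> CARD('n) + 1"
  shows "\<exists>P :: (real ^ 'n) set.
           stacked_polytope CARD('n) P \<and> card (vertices P) = N \<and> universally_inscribable P"
proof -
  let ?d = "CARD('n)"
  have dim: "DIM(real ^ 'n) = ?d" "DIM(real ^ 'n) \<ge> 2" using assms(1) by simp_all
  obtain k where k: "N = Suc (k + ?d)" using assms(2) by (metis Suc_eq_plus1 add.commute add.left_commute le_iff_add)
  let ?I = "{..k + ?d}"
  note ex = ex_inscribed_stacking[where 'a = "real ^ 'n" and k = k, OF dim(2), unfolded dim(1)]
  note card = conjunct2[OF stacking_family_subset_card[of _ ?d k]]
  have vert: "vertices (convex hull (p ` ?I)) = p ` ?I" "inj_on p ?I"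
    if "aff_dim (p ` ?I) = ?d" "facet_sets p ?I = stacking_family ?d k" for p :: "nat \<Rightarrow> real ^ 'n"
    using vertices_eq_image[of ?I p] that card Union_stacking_family[OF assms(1)] dim(1) by simp_all
  obtain p :: "nat \<Rightarrow> real ^ 'n" where p: "aff_dim (p ` ?I) = ?d"
    "facet_sets p ?I = stacking_family ?d k" "stacked_polytope ?d (convex hull (p ` ?I))"
    using ex[OF cball_smooth_strictly_convex] by blast
  have "inscribable K (convex hull (p ` ?I))"
    if K: "convex_body K" "smooth_body K" "strictly_convex K" for K
  proof -
    obtain q :: "nat \<Rightarrow> real ^ 'n" where q: "q ` ?I \<subseteq> frontier K" "aff_dim (q ` ?I) = ?d"
      "facet_sets q ?I = stacking_family ?d k"
      using ex[OF K] by blast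
    have "inscribed K (convex hull (q ` ?I))"
      unfolding inscribed_def using vert(1)[OF q(2,3)] q(1) by (simp add: polytope_convex_hull)
    moreover have "combinatorially_equivalent (convex hull (p ` ?I)) (convex hull (q ` ?I))"
      using p(2) q(3) by (intro combinatorially_equivalentI) simp_all
    ultimately show ?thesis unfolding inscribable_def by blast
  qed
  then have "universally_inscribable (convex hull (p ` ?I))"
    unfolding universally_inscribable_def by blast
  moreover have "card (vertices (convex hull (p ` ?I))) = N"
    using vert[OF p(1,2)] card_image k by fastforce
  ultimately show ?thesis using p(3) by blast
qed

end
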